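(* For every $\gamma > 0$ there is $t_0$ such that the following holds. Let $\mathcal H$ be a 3-uniform hypergraph with $t > t_0$ vertices and at least $(1-\gamma)\binom{t}{3}$ edges. Then every 2-colouring of the edges of $\mathcal H$ admits two disjoint monochromatic connected matchings which together cover at least $(1-290\gamma^{1/6})\,t$ vertices of $\mathcal H$.
   Context: A matching in a 3-uniform hypergraph $\mathcal H$ is a set of pairwise disjoint edges. A pseudo-path in $\mathcal H$ connecting edges $e$ and $f$ is a sequence $(e_1,\dots,e_p)$ of not necessarily distinct edges of $\mathcal H$ with $e_1=e$, $e_p=f$ and $|e_i\cap e_{i+1}|=2$ for all $i\in[p-1]$. A matching $\mathcal M\subseteq\mathcal H$ is connected if every pair of edges $e,f\in\mathcal M$ is connected by a pseudo-path in $\mathcal H$ (the pseudo-paths may use vertices outside $V(\mathcal M)$). The vertices covered by $\mathcal M$ are those in $V(\mathcal M)=\bigcup_{e\in\mathcal M}e$ only, and two connected matchings are disjoint if their sets of covered vertices are disjoint. A connected matching is monochromatic if all edges of $\mathcal M$ and all edges of the connecting pseudo-paths have the same colour (i.e. it is a connected matching within a single colour class). *)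

theory Defs
  imports Complex_Main
begin

definition uniform_hypergraph :: "nat \<Rightarrow> 'a set \<Rightarrow> 'a set set \<Rightarrow> bool" where
  "uniform_hypergraph k V E \<longleftrightarrow> finite V \<and> (\<forall>e\<in>E. e \<subseteq> V \<and> card e = k)"

text \<open>The empty set of edges counts as a matching.\<close>

definition matching :: "'a set set \<Rightarrow> 'a set set \<Rightarrow> bool" where
  "matching E M \<longleftrightarrow> M \<subseteq> E \<and> pairwise disjnt M"

text \<open>The intersection size 2 is the one for 3-uniform hypergraphs. Edges may be repeated,
  but consecutive ones are distinct because they meet in 2 vertices only; the one-element
  sequence connects an edge to itself.\<close>

definition pseudo_path :: "'a set set \<Rightarrow> 'a set \<Rightarrow> 'a set \<Rightarrow> 'a set list \<Rightarrow> bool" where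
  "pseudo_path E e f es \<longleftrightarrow>
     es \<noteq> [] \<and> set es \<subseteq> E \<and> hd es = e \<and> last es = f \<and>
     (\<forall>i. Suc i < length es \<longrightarrow> card (es ! i \<inter> es ! Suc i) = 2)"

definition connected_matching :: "'a set set \<Rightarrow> 'a set set \<Rightarrow> bool" where
  "connected_matching E M \<longleftrightarrow>
     matching E M \<and> (\<forall>e\<in>M. \<forall>f\<in>M. \<exists>es. pseudo_path E e f es)"

definition covered :: "'a set set \<Rightarrow> 'a set" where
  "covered M = \<Union>M"

text \<open>A 2-colouring of the edges is a function into the two-element type \<^typ>\<open>bool\<close>;
  its values outside the edge set are irrelevant.\<close>

definition colour_class :: "'a set set \<Rightarrow> ('a set \<Rightarrow> bool) \<Rightarrow> bool \<Rightarrow> 'a set set" where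
  "colour_class E c i = {e \<in> E. c e = i}"

definition mono_connected_matching ::
    "'a set set \<Rightarrow> ('a set \<Rightarrow> bool) \<Rightarrow> 'a set set \<Rightarrow> bool" where
  "mono_connected_matching E c M \<longleftrightarrow> (\<exists>i. connected_matching (colour_class E c i) M)"

end

theory Submission
  imports Defs
begin

text \<open>Put $\eta = \gamma^{1/6}$. A 2-coloured almost complete graph has a monochromatic component on
  almost all vertices. Applied to the link graph of a typical vertex $x$, this gives a colour
  $k(x)$ and a tight component of that colour which contains all edges of colour $k(x)$ through $x$ and
  almost any other vertex $y$. If two typical vertices of the same colour are each such a $y$ for the
  other, their components coincide; hence all vertices with $k(x) = i$ share one component of
  colour $i$. With $A$ the larger of the two vertex classes and $B$ the other, an edge meeting both
  $A$ and $B$ lies in one of the two components, whatever its colour, and greedily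
  chosen mixed edges cover almost everything if $|A| \le 2|B|$. Otherwise first remove
  disjoint edges inside $A$ of colour $k(A)$ until the sizes are balanced, or until all edges left inside
  $A$ have the other colour; these lie in a single component, and edges with at
  least two vertices in $A$ cover what remains.\<close>

section \<open>Tight components\<close>

definition adj :: "'a set set \<Rightarrow> 'a set \<Rightarrow> 'a set \<Rightarrow> bool" where
  "adj F e f \<longleftrightarrow> e \<in> F \<and> f \<in> F \<and> card (e \<inter> f) = 2"

abbreviation tight :: "'a set set \<Rightarrow> 'a set \<Rightarrow> 'a set \<Rightarrow> bool" where
  "tight F \<equiv> (adj F)\<^sup>*\<^sup>*"

lemma tight_sym: "tight F e f \<Longrightarrow> tight F f e"
proof -
  have "symp (adj F)" by (auto simp: symp_def adj_def Int_commute)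
  then show "tight F e f \<Longrightarrow> tight F f e" by (meson symp_rtranclp sympD)
qed

text \<open>Two 3-sets with two common vertices either coincide or meet in exactly two vertices;
  reflexivity of the closure settles the first case.\<close>

lemma tight_share:
  assumes "e \<in> F" "f \<in> F" "card e = 3" "card f = 3"
    and "x \<in> e" "y \<in> e" "x \<in> f" "y \<in> f" "x \<noteq> y"
  shows "tight F e f"
proof (cases "e = f")
  case False
  have fin: "finite e" "finite f" using assms(3,4) by (auto intro: card_ge_0_finite)
  have "card {x, y} \<le> card (e \<inter> f)" using assms fin by (intro card_mono) auto
  moreover have "e \<inter> f \<subset> e"
    using False fin assms(3,4) by (metis card_subset_eq inf.orderI inf_le1 psubsetI inf_commute)
  then have "card (e \<inter> f) < 3" using psubset_card_mono[OF fin(1)] assms(3) by metis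
  ultimately have "card (e \<inter> f) = 2" using assms(9) by simp
  then show ?thesis using assms by (intro r_into_rtranclp) (simp add: adj_def)
qed simp

text \<open>The closure is reflexive even outside \<open>F\<close>, whereas a pseudo-path runs
  through edges of \<open>F\<close> only; hence the condition \<open>e \<in> F\<close>.\<close>

lemma tight_imp_pseudo_path:
  assumes "tight F e f" "e \<in> F"
  shows "\<exists>es. pseudo_path F e f es"
  using assms
proof (induction rule: rtranclp_induct)
  case base
  then have "pseudo_path F e e [e]" by (simp add: pseudo_path_def)
  then show ?case ..
next
  case (step g h)
  then obtain es where es: "pseudo_path F e g es" by auto
  have "card ((es @ [h]) ! i \<inter> (es @ [h]) ! Suc i) = 2" if "Suc i < length (es @ [h])" for i
  proof (cases "Suc i < length es")
    case True
    then show ?thesis using es by (simp add: pseudo_path_def nth_append)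
  next
    case False
    then have "i = length es - 1" "es \<noteq> []" using that es by (auto simp: pseudo_path_def)
    then show ?thesis using es step.hyps(2)
      by (auto simp: pseudo_path_def nth_append adj_def last_conv_nth)
  qed
  then have "pseudo_path F e h (es @ [h])"
    using es step.hyps(2) by (auto simp: pseudo_path_def adj_def)
  then show ?case ..
qed

section \<open>Two-coloured almost complete graphs\<close>

lemma real_card_Diff:
  assumes "finite A" "B \<subseteq> A"
  shows "real (card (A - B)) = real (card A) - real (card B)"
  using assms by (simp add: card_Diff_subset card_mono finite_subset of_nat_diff)

text \<open>Union bound. The conditions form a list, so they are counted correctly even if two of
  them coincide.\<close>

lemma ex_avoid:
  fixes s :: real
  assumes "finite S" "\<forall>P\<in>set Ps. card {z\<in>S. P z} \<le> s" "card S > length Ps * s"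
  shows "\<exists>z\<in>S. \<forall>P\<in>set Ps. \<not> P z"
proof (rule ccontr)
  assume "\<not> ?thesis"
  then have sub: "S \<subseteq> (\<Union>P\<in>set Ps. {z\<in>S. P z})" by blast
  have "card (\<Union>P\<in>set Ps. {z\<in>S. P z}) \<le> length Ps * s"
    using assms(2)
  proof (induction Ps)
    case (Cons Q Ps)
    have "card (\<Union>P\<in>set (Q # Ps). {z\<in>S. P z})
        \<le> card {z\<in>S. Q z} + card (\<Union>P\<in>set Ps. {z\<in>S. P z})"
      by (simp add: card_Un_le)
    moreover have "card {z\<in>S. Q z} \<le> s"
      "card (\<Union>P\<in>set Ps. {z\<in>S. P z}) \<le> length Ps * s" using Cons by auto
    ultimately show ?case by (simp add: algebra_simps)
  qed simp
  moreover have "card S \<le> card (\<Union>P\<in>set Ps. {z\<in>S. P z})"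
    using assms(1) by (intro card_mono[OF _ sub]) auto
  ultimately show False using assms(3) by linarith
qed

text \<open>Either \<open>True\<close> has a cut with more than \<open>2 * d\<close> vertices on
  both sides, and then \<open>False\<close> connects all of \<open>N\<close> across it, or every cut
  is lopsided and a single \<open>True\<close> component misses at most \<open>4 * d\<close>
  vertices. The connecting walks may leave \<open>C\<close>.\<close>

lemma two_colour_component:
  fixes P :: "bool \<Rightarrow> 'a \<Rightarrow> 'a \<Rightarrow> bool" and d :: real
  assumes fin: "finite N" and sym: "\<And>i u v. P i u v \<Longrightarrow> P i v u"
    and deg: "\<And>y. y \<in> N \<Longrightarrow> card {z\<in>N. \<forall>i. \<not> P i y z} \<le> d"
    and big: "card N > 6 * d" and d: "d \<ge> 0"
  obtains i C where "C \<subseteq> N" "card C \<ge> card N - 4 * d"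
    "\<And>y z. \<lbrakk>y \<in> C; z \<in> C\<rbrakk> \<Longrightarrow> (P i)\<^sup>*\<^sup>* y z"
proof -
  have symr: "(P i)\<^sup>*\<^sup>* u v \<Longrightarrow> (P i)\<^sup>*\<^sup>* v u" for i u v
    using symp_rtranclp[of "P i"] sym by (auto simp: symp_def)
  define closed where "closed A \<longleftrightarrow> A \<subseteq> N \<and> (\<forall>u\<in>A. \<forall>v\<in>N. P True u v \<longrightarrow> v \<in> A)" for A
  show thesis
  proof (cases "\<exists>A. closed A \<and> card A > 2 * d \<and> card (N - A) > 2 * d")
    case True
    \<comment> \<open>No \<open>True\<close>-edge joins \<open>A\<close> to its complement, so this is almost complete bipartite in \<open>False\<close>.\<close>
    then obtain A where A: "closed A" "card A > 2 * d" "card (N - A) > 2 * d" by auto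
    \<comment> \<open>Each of \<open>x\<close> and \<open>x'\<close> is joined in neither colour to
      at most \<open>d\<close> vertices. Since \<open>True\<close> is excluded on \<open>Y\<close>,
      more than \<open>2 * d\<close> vertices leave a common \<open>False\<close> neighbour.\<close>
    have common: "\<exists>y\<in>Y. P False x y \<and> P False x' y"
      if "x \<in> N" "x' \<in> N" "Y \<subseteq> N" "card Y > 2 * d" and red: "\<And>y. y \<in> Y \<Longrightarrow> \<not> P True x y \<and> \<not> P True x' y"
      for x x' Y
    proof -
      have fY: "finite Y" using that(3) fin finite_subset by blast
      have le: "card {z\<in>Y. \<not> P False w z} \<le> d" if w: "w \<in> {x, x'}" for w
      proof -
        have "{z\<in>Y. \<not> P False w z} \<subseteq> {z\<in>N. \<forall>i. \<not> P i w z}"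
          using red \<open>Y \<subseteq> N\<close> w by (auto simp: all_bool_eq)
        then have "card {z\<in>Y. \<not> P False w z} \<le> card {z\<in>N. \<forall>i. \<not> P i w z}"
          using fin by (intro card_mono) auto
        moreover have "card {z\<in>N. \<forall>i. \<not> P i w z} \<le> d"
          using w \<open>x \<in> N\<close> \<open>x' \<in> N\<close> by (intro deg) auto
        ultimately show ?thesis by linarith
      qed
      then have "\<exists>z\<in>Y. \<forall>Q\<in>set [\<lambda>z. \<not> P False x z, \<lambda>z. \<not> P False x' z]. \<not> Q z"
        using that(4) by (intro ex_avoid[where s = d] fY) auto
      then show ?thesis by auto
    qed
    have AN: "A \<subseteq> N" and no: "\<And>a b. a \<in> A \<Longrightarrow> b \<in> N - A \<Longrightarrow> \<not> P True a b \<and> \<not> P True b a"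
      using A(1) sym unfolding closed_def by blast+
    have cA: "\<exists>b\<in>N-A. P False x b \<and> P False y b" if "x \<in> A" "y \<in> A" for x y
      using that AN no A(3) by (intro common) auto
    have cB: "\<exists>a\<in>A. P False x a \<and> P False y a" if "x \<in> N - A" "y \<in> N - A" for x y
      using that AN no A(2) by (intro common) auto
    have conA: "(P False)\<^sup>*\<^sup>* x y" if xy: "x \<in> A" "y \<in> A" for x y
    proof -
      obtain b where "P False x b" "P False y b" using cA[OF xy] by blast
      then show ?thesis using sym[of False y b]
        by (auto intro: rtranclp.rtrancl_into_rtrancl[of _ x b])
    qed
    have conB: "\<exists>a\<in>A. (P False)\<^sup>*\<^sup>* x a" if "x \<in> N" for x
      using cB[of x x] that by (cases "x \<in> A") blast+
    have "(P False)\<^sup>*\<^sup>* x y" if x: "x \<in> N" and y: "y \<in> N" for x y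
    proof -
      obtain a b where "a \<in> A" "(P False)\<^sup>*\<^sup>* x a" "b \<in> A" "(P False)\<^sup>*\<^sup>* y b"
        using conB[OF x] conB[OF y] by blast
      then show ?thesis using conA[of a b] symr[of False y b] by (meson rtranclp_trans)
    qed
    then show thesis using d by (intro that[of N False]) auto
  next
    case False
    \<comment> \<open>A least closed set that misses few vertices is, up to few vertices, one component.\<close>
    let ?Q = "\<lambda>A. closed A \<and> card A \<ge> card N - 2 * d"
    have "?Q N" using d by (simp add: closed_def)
    then obtain A where A: "closed A" "card A \<ge> card N - 2 * d"
      and least: "\<And>A'. ?Q A' \<Longrightarrow> card A \<le> card A'"
      using ex_has_least_nat[of ?Q N card] by blast
    have AN: "A \<subseteq> N" and fA: "finite A" using A(1) fin by (auto simp: closed_def intro: finite_subset)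
    have "card A > 0" using A(2) big d by linarith
    then obtain a where a: "a \<in> A" by (metis card_gt_0_iff ex_in_conv)
    define C where "C = {v\<in>A. (P True)\<^sup>*\<^sup>* a v}"
    have CA: "C \<subseteq> A" "a \<in> C" using a by (auto simp: C_def)
    have "v \<in> A - C" if "u \<in> A - C" "v \<in> N" "P True u v" for u v
    proof -
      have "v \<in> A" using that A(1) by (auto simp: closed_def)
      moreover have "v \<notin> C"
      proof
        assume "v \<in> C"
        then have "(P True)\<^sup>*\<^sup>* a u" using sym[OF that(3)] by (auto simp: C_def)
        then show False using that(1) by (simp add: C_def)
      qed
      ultimately show ?thesis by simp
    qed
    then have cl: "closed (A - C)" using AN unfolding closed_def by blast
    have "card (A - C) < card A" using CA fA by (intro psubset_card_mono) auto
    \<comment> \<open>By minimality the closed set \<open>A - C\<close> misses more than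
      \<open>2 * d\<close> vertices; as no cut has two large sides, \<open>A - C\<close> itself has
      at most \<open>2 * d\<close>.\<close>
    then have "\<not> card (A - C) \<ge> card N - 2 * d" using least[of "A - C"] cl by auto
    moreover have "card (N - (A - C)) = card N - real (card (A - C))"
      using AN fin by (intro real_card_Diff) auto
    ultimately have "card (A - C) \<le> 2 * d" using False cl by (smt (verit))
    moreover have "card (A - C) = card A - real (card C)"
      using CA fA by (intro real_card_Diff)
    ultimately have "card C \<ge> card N - 4 * d" using A(2) by linarith
    moreover have "(P True)\<^sup>*\<^sup>* y z" if "y \<in> C" "z \<in> C" for y z
      using that symr by (auto simp: C_def intro: rtranclp_trans)
    ultimately show thesis using CA AN by (intro that[of C True]) auto
  qed
qed

section \<open>Greedy covering\<close>

text \<open>\<open>M\<close> has to stay inside \<open>S\<close>, so that an edge removed from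
  \<open>S\<close> beforehand is disjoint from a covering of the rest.\<close>

definition covers_but :: "'a set set \<Rightarrow> 'a set \<Rightarrow> real \<Rightarrow> bool" where
  "covers_but F S k \<longleftrightarrow>
     (\<exists>M\<subseteq>F. pairwise disjnt M \<and> \<Union>M \<subseteq> S \<and> real (card (S - \<Union>M)) \<le> k)"

lemma covers_but_small: "real (card S) \<le> k \<Longrightarrow> covers_but F S k"
  unfolding covers_but_def by (intro exI[of _ "{}"]) auto

lemma covers_but_insert:
  assumes "covers_but F (S - e) k" "e \<in> F" "e \<subseteq> S"
  shows "covers_but F S k"
proof -
  obtain M where M: "M \<subseteq> F" "pairwise disjnt M" "\<Union>M \<subseteq> S - e" "real (card (S - e - \<Union>M)) \<le> k"
    using assms(1) by (auto simp: covers_but_def)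
  have "S - \<Union>(insert e M) = S - e - \<Union>M" by auto
  moreover have "pairwise disjnt (insert e M)"
    using M(2,3) by (auto simp: pairwise_insert disjnt_def)
  ultimately show ?thesis unfolding covers_but_def
    using M assms(2,3) by (intro exI[of _ "insert e M"]) auto
qed

lemma covers_but_mono: "covers_but F S k \<Longrightarrow> k \<le> l \<Longrightarrow> covers_but F S l"
  unfolding covers_but_def by (meson order_trans)

text \<open>Empty if \<open>e\<close> is not in \<open>F\<close>, so \<open>e\<close> may serve as
  an anchor without being known to be an edge.\<close>

definition tight_component :: "'a set set \<Rightarrow> 'a set \<Rightarrow> 'a set set" where
  "tight_component F e = {f \<in> F. tight F e f}"

text \<open>What remains of the hypergraph after the exceptional vertices are dropped. A single
  \<open>s\<close> bounds all exceptional sets, and \<open>s \<ge> 1\<close> absorbs additive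
  constants. The exceptional sets include the degenerate choices, such as \<open>y = x\<close> or
  \<open>z = x\<close>.\<close>

locale nice_pairs =
  fixes E :: "'a set set" and c :: "'a set \<Rightarrow> bool" and U :: "'a set"
    and nice :: "'a \<Rightarrow> 'a \<Rightarrow> bool" and s :: real
  assumes card_edge: "e \<in> E \<Longrightarrow> card e = 3"
    and finite_U: "finite U"
    and nice_sym: "nice x y \<Longrightarrow> nice y x"
    and nice_neq: "nice x y \<Longrightarrow> x \<noteq> y"
    and card_not_nice: "x \<in> U \<Longrightarrow> card {y\<in>U. \<not> nice x y} \<le> s"
    and card_non_edge: "\<lbrakk>x \<in> U; y \<in> U; nice x y\<rbrakk> \<Longrightarrow> card {z\<in>U. {x, y, z} \<notin> E} \<le> s"
    and s_ge_1: "s \<ge> 1"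
begin

abbreviation "F \<equiv> colour_class E c"

definition triple :: "'a \<Rightarrow> 'a \<Rightarrow> 'a \<Rightarrow> bool" where
  "triple x y z \<longleftrightarrow> nice x y \<and> nice x z \<and> nice y z \<and> {x, y, z} \<in> E"

lemma ex_avoid_U:
  assumes "S \<subseteq> U" "\<forall>P\<in>set Ps. card {z\<in>U. P z} \<le> s" "card S > length Ps * s"
  shows "\<exists>z\<in>S. \<forall>P\<in>set Ps. \<not> P z"
proof (rule ex_avoid[OF finite_subset[OF assms(1) finite_U] _ assms(3)])
  have "card {z\<in>S. P z} \<le> card {z\<in>U. P z}" for P
    using assms(1) finite_U by (intro card_mono) auto
  then show "\<forall>P\<in>set Ps. card {z\<in>S. P z} \<le> s"
    using assms(2) by (meson of_nat_mono order_trans)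
qed

text \<open>Three conditions on \<open>z\<close>, each violated by at most \<open>s\<close>
  vertices, account for \<open>3 * s\<close>.\<close>

lemma ex_triple:
  assumes "S \<subseteq> U" "x \<in> U" "y \<in> U" "nice x y" "card S > 3 * s"
  shows "\<exists>z\<in>S. triple x y z"
proof -
  have "\<exists>z\<in>S. \<forall>P\<in>set [\<lambda>z. \<not> nice x z, \<lambda>z. \<not> nice y z, \<lambda>z. {x, y, z} \<notin> E]. \<not> P z"
    using assms card_not_nice card_non_edge by (intro ex_avoid_U) auto
  then show ?thesis using assms(4) by (auto simp: triple_def)
qed

lemma ex_triple2:
  assumes "S \<subseteq> U" "x \<in> U" "card S > 3 * s"
  shows "\<exists>y\<in>S. \<exists>z\<in>S. triple x y z"
proof -
  have "\<exists>y\<in>S. \<forall>P\<in>set [\<lambda>y. \<not> nice x y]. \<not> P y"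
    using assms card_not_nice s_ge_1 by (intro ex_avoid_U) auto
  then obtain y where "y \<in> S" "nice x y" by auto
  then show ?thesis using ex_triple[OF assms(1,2), of y] assms by auto
qed

lemma triple_distinct: "triple x y z \<Longrightarrow> x \<noteq> y \<and> x \<noteq> z \<and> y \<noteq> z"
  using nice_neq by (auto simp: triple_def)

text \<open>While \<open>B\<close> is nonempty, each chosen edge takes one vertex of
  \<open>B\<close> and two of \<open>A\<close>, which preserves
  \<open>2 * card B \<le> card A\<close>; afterwards edges lie inside \<open>A\<close>. The choice
  stops at \<open>card A \<le> 3 * s\<close>, with at most \<open>9/2 * s\<close> vertices
  left.\<close>

lemma covers_unbalanced:
  assumes "A \<subseteq> U" "B \<subseteq> U" "A \<inter> B = {}" "2 * card B \<le> card A"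
    and "\<And>x y z. \<lbrakk>x \<in> A \<union> B; y \<in> A; z \<in> A; triple x y z\<rbrakk> \<Longrightarrow> {x, y, z} \<in> G"
  shows "covers_but G (A \<union> B) (5 * s)"
  using assms
proof (induction "card A" arbitrary: A B rule: less_induct)
  case less
  have fin: "finite A" "finite B" using less.prems finite_U finite_subset by auto
  show ?case
  proof (cases "card A > 3 * s")
    case False
    have "card (A \<union> B) \<le> card A + card B" by (rule card_Un_le)
    then have "real (card (A \<union> B)) \<le> 5 * s" using False less.prems(4) s_ge_1 by linarith
    then show ?thesis by (rule covers_but_small)
  next
    case True
    then have "A \<noteq> {}" using s_ge_1 by auto
    then obtain x where x: "x \<in> A \<union> B" "B \<noteq> {} \<longrightarrow> x \<in> B" by blast
    obtain y z where yz: "y \<in> A" "z \<in> A" "triple x y z"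
      using ex_triple2[OF less.prems(1) _ True, of x] x less.prems(1,2) by auto
    note ne = triple_distinct[OF yz(3)]
    have "card (A - {x, y, z}) < card A"
      using yz fin by (intro psubset_card_mono) auto
    moreover have "2 * card (B - {x, y, z}) \<le> card (A - {x, y, z})"
    proof (cases "B = {}")
      case False
      then have "x \<in> B" using x by simp
      then have "A - {x, y, z} = A - {y, z}" "B - {x, y, z} = B - {x}"
        using yz less.prems(3) by auto
      then show ?thesis using yz ne fin \<open>x \<in> B\<close> less.prems(4) by (simp add: card_Diff_subset)
    qed simp
    ultimately have "covers_but G ((A - {x, y, z}) \<union> (B - {x, y, z})) (5 * s)"
      using less.prems by (intro less.hyps) auto
    then have cov: "covers_but G (A \<union> B - {x, y, z}) (5 * s)" by (simp only: Un_Diff)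
    have "{x, y, z} \<in> G" using x yz less.prems(5) by auto
    then show ?thesis using x yz by (intro covers_but_insert[OF cov]) auto
  qed
qed

text \<open>Each chosen edge takes two vertices of the currently larger class and one of the
  smaller. The roles may then swap, so the hypotheses are symmetric in the classes. At most
  \<open>6 * s\<close> vertices are left when the larger class has shrunk to
  \<open>3 * s\<close>.\<close>

lemma covers_balanced:
  assumes "A \<subseteq> U" "B \<subseteq> U" "A \<inter> B = {}" "card B \<le> 2 * card A" "card A \<le> 2 * card B"
    and "\<And>x y z. \<lbrakk>triple x y z; {x, y, z} \<subseteq> A \<union> B; \<not> {x, y, z} \<subseteq> A; \<not> {x, y, z} \<subseteq> B\<rbrakk>
      \<Longrightarrow> {x, y, z} \<in> G"
  shows "covers_but G (A \<union> B) (9 * s)"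
  using assms
proof (induction "card (A \<union> B)" arbitrary: A B rule: less_induct)
  case (less A' B')
  obtain A B where AB: "A \<subseteq> U" "B \<subseteq> U" "A \<inter> B = {}" "card B \<le> card A" "card A \<le> 2 * card B"
    and eq: "A' \<union> B' = A \<union> B"
    and G: "\<And>x y z. \<lbrakk>triple x y z; {x, y, z} \<subseteq> A \<union> B; \<not> {x, y, z} \<subseteq> A; \<not> {x, y, z} \<subseteq> B\<rbrakk>
      \<Longrightarrow> {x, y, z} \<in> G"
  proof (cases "card B' \<le> card A'")
    case True
    show ?thesis by (rule that[of A' B']) (use less.prems True in auto)
  next
    case False
    show ?thesis by (rule that[of B' A']) (use less.prems False in auto)
  qed
  have fin: "finite A" "finite B" using AB(1,2)[THEN finite_subset, OF finite_U] .
  have "covers_but G (A \<union> B) (9 * s)"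
  proof (cases "card A > 3 * s")
    case False
    have "card (A \<union> B) \<le> card A + card B" by (rule card_Un_le)
    then have "real (card (A \<union> B)) \<le> 9 * s" using False AB(4) s_ge_1 by linarith
    then show ?thesis by (rule covers_but_small)
  next
    case True
    \<comment> \<open>This gives \<open>card B - 1 \<le> card A - 1 \<le> 2 * (card A - 2)\<close>,
      one of the two inequalities for the remaining classes; the other follows from
      \<open>card A \<le> 2 * card B\<close>.\<close>
    then have A3: "card A > 3" using s_ge_1 by linarith
    then have "B \<noteq> {}" using AB(5) by auto
    then obtain x where x: "x \<in> B" by auto
    obtain y z where yz: "y \<in> A" "z \<in> A" "triple x y z"
      using ex_triple2[OF AB(1) _ True, of x] x AB(2) by auto
    note ne = triple_distinct[OF yz(3)]
    have sub: "A - {x, y, z} = A - {y, z}" "B - {x, y, z} = B - {x}"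
      using x yz AB(3) by auto
    have cards: "card (A - {x, y, z}) = card A - 2" "card (B - {x, y, z}) = card B - 1"
      unfolding sub using x yz ne fin by (simp_all add: card_Diff_subset)
    have "card ((A - {x, y, z}) \<union> (B - {x, y, z})) < card (A' \<union> B')"
      unfolding eq using x fin by (intro psubset_card_mono) auto
    moreover have "{u, v, w} \<in> G"
      if "triple u v w" "{u, v, w} \<subseteq> (A - {x, y, z}) \<union> (B - {x, y, z})"
        "\<not> {u, v, w} \<subseteq> A - {x, y, z}" "\<not> {u, v, w} \<subseteq> B - {x, y, z}" for u v w
      by (rule G) (use that in auto)
    ultimately have "covers_but G ((A - {x, y, z}) \<union> (B - {x, y, z})) (9 * s)"
      using AB A3 cards by (intro less.hyps) auto
    then have cov: "covers_but G (A \<union> B - {x, y, z}) (9 * s)" by (simp only: Un_Diff)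
    have "{x, y, z} \<in> G" using G[OF yz(3)] x yz AB(3) by auto
    then show ?thesis using x yz by (intro covers_but_insert[OF cov]) auto
  qed
  then show ?case unfolding eq .
qed

text \<open>A vertex \<open>p\<close> completes both \<open>{x, y}\<close> and
  \<open>{u, v}\<close>, and a vertex \<open>q\<close> completes both \<open>{x, p}\<close> and
  \<open>{u, p}\<close>; consecutive edges of the resulting chain share a nice pair. The choice of
  \<open>p\<close> has six conditions, hence the bound \<open>6 * s\<close>.\<close>

lemma tight_triples:
  assumes A: "A \<subseteq> U" "card A > 6 * s"
    and mono: "\<And>x y z. \<lbrakk>x \<in> A; y \<in> A; z \<in> A; triple x y z\<rbrakk> \<Longrightarrow> c {x, y, z} = j"
    and "x \<in> A" "y \<in> A" "z \<in> A" "triple x y z" "u \<in> A" "v \<in> A" "w \<in> A" "triple u v w"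
  shows "tight (F j) {x, y, z} {u, v, w}"
proof -
  have nice: "nice x y" "nice u v" using assms by (auto simp: triple_def)
  have "\<exists>p\<in>A. \<forall>P\<in>set [\<lambda>p. \<not> nice x p, \<lambda>p. \<not> nice y p, \<lambda>p. \<not> nice u p, \<lambda>p. \<not> nice v p,
      \<lambda>p. {x, y, p} \<notin> E, \<lambda>p. {u, v, p} \<notin> E]. \<not> P p"
    using assms nice card_not_nice card_non_edge by (intro ex_avoid_U) (auto simp: subset_iff)
  then obtain p where p: "p \<in> A" "triple x y p" "triple u v p"
    using nice by (auto simp: triple_def)
  have np: "nice x p" "nice u p" using p by (auto simp: triple_def)
  have "\<exists>q\<in>A. \<forall>P\<in>set [\<lambda>q. \<not> nice x q, \<lambda>q. \<not> nice p q, \<lambda>q. \<not> nice u q,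
      \<lambda>q. {x, p, q} \<notin> E, \<lambda>q. {u, p, q} \<notin> E]. \<not> P q"
    using assms p np s_ge_1 card_not_nice card_non_edge by (intro ex_avoid_U) (auto simp: subset_iff)
  then obtain q where q: "q \<in> A" "triple x p q" "triple u p q"
    using np by (auto simp: triple_def)
  have inF: "{a, b, d} \<in> F j" if "a \<in> A" "b \<in> A" "d \<in> A" "triple a b d" for a b d
    using mono[OF that] that by (auto simp: triple_def colour_class_def)
  have sh: "tight (F j) e f" if "e \<in> F j" "f \<in> F j" "a \<in> e" "b \<in> e" "a \<in> f" "b \<in> f" "nice a b" for e f a b
    using that card_edge nice_neq by (intro tight_share[of _ _ _ a b]) (auto simp: colour_class_def)
  note ins = inF[OF assms(4-7)] inF[OF assms(8-11)] inF[OF assms(4,5) p(1,2)] inF[OF assms(8,9) p(1,3)]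
    inF[OF assms(4) p(1) q(1,2)] inF[OF assms(8) p(1) q(1,3)]
  have "tight (F j) {x, y, z} {x, y, p}" by (rule sh[of _ _ x y]) (use ins nice in auto)
  also have "tight (F j) {x, y, p} {x, p, q}" by (rule sh[of _ _ x p]) (use ins np in auto)
  also have "tight (F j) {x, p, q} {u, p, q}"
    by (rule sh[of _ _ p q]) (use ins q in \<open>auto simp: triple_def\<close>)
  also have "tight (F j) {u, p, q} {u, v, p}" by (rule sh[of _ _ u p]) (use ins np in auto)
  also have "tight (F j) {u, v, p} {u, v, w}" by (rule sh[of _ _ u v]) (use ins nice in auto)
  finally show ?thesis .
qed

text \<open>The component of colour \<open>\<not> i\<close> is existentially quantified because it need not be that
  of \<open>eB\<close>: when edges inside \<open>A\<close> of colour \<open>\<not> i\<close> are used and no mixed edge links them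
  to \<open>eB\<close>, all mixed edges with two vertices in \<open>A\<close> have colour \<open>i\<close>.\<close>

lemma ex_covers:
  assumes "A \<subseteq> U" "B \<subseteq> U" "A \<inter> B = {}"
    and "card B \<le> 2 * card A \<or> card A + card B \<le> 9 * s"
    and "\<And>x y e. \<lbrakk>x \<in> A; y \<in> U; nice x y; e \<in> F i; x \<in> e; y \<in> e\<rbrakk> \<Longrightarrow> tight (F i) eA e"
    and "\<And>x y e. \<lbrakk>x \<in> B; y \<in> U; nice x y; e \<in> F (\<not> i); x \<in> e; y \<in> e\<rbrakk> \<Longrightarrow> tight (F (\<not> i)) eB e"
  shows "\<exists>f. covers_but (tight_component (F i) eA \<union> tight_component (F (\<not> i)) f) (A \<union> B) (9 * s)"
  using assms
proof (induction "card A" arbitrary: A rule: less_induct)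
  case less
  have fin: "finite A" "finite B" using less.prems finite_U finite_subset by auto
  have cardU: "card (A \<union> B) = card A + card B" using fin less.prems(3) by (simp add: card_Un_disjoint)
  have compA: "{x, y, z} \<in> tight_component (F i) eA"
    if "triple x y z" "x \<in> A \<or> y \<in> A \<or> z \<in> A" "x \<in> U" "y \<in> U" "z \<in> U" "c {x, y, z} = i" for x y z
  proof -
    have *: "{x, y, z} \<in> F i" using that by (auto simp: triple_def colour_class_def)
    have "tight (F i) eA {x, y, z}"
      using that(2) less.prems(5)[OF _ _ _ *, of x y] less.prems(5)[OF _ _ _ *, of y x]
        less.prems(5)[OF _ _ _ *, of z x] that nice_sym by (auto simp: triple_def)
    then show ?thesis using * by (simp add: tight_component_def)
  qed
  have compB: "{x, y, z} \<in> tight_component (F (\<not> i)) eB"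
    if "triple x y z" "x \<in> B \<or> y \<in> B \<or> z \<in> B" "x \<in> U" "y \<in> U" "z \<in> U" "c {x, y, z} \<noteq> i" for x y z
  proof -
    have *: "{x, y, z} \<in> F (\<not> i)" using that by (auto simp: triple_def colour_class_def)
    have "tight (F (\<not> i)) eB {x, y, z}"
      using that(2) less.prems(6)[OF _ _ _ *, of x y] less.prems(6)[OF _ _ _ *, of y x]
        less.prems(6)[OF _ _ _ *, of z x] that nice_sym by (auto simp: triple_def)
    then show ?thesis using * by (simp add: tight_component_def)
  qed
  consider (small) "card A + card B \<le> 9 * s"
    | (balanced) "card B \<le> 2 * card A" "card A \<le> 2 * card B"
    | (remove) x y z where "2 * card B < card A" "x \<in> A" "y \<in> A" "z \<in> A" "triple x y z" "c {x, y, z} = i"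
    | (final) "2 * card B < card A" "card A + card B > 9 * s"
        "\<And>x y z. \<lbrakk>x \<in> A; y \<in> A; z \<in> A; triple x y z\<rbrakk> \<Longrightarrow> c {x, y, z} = (\<not> i)"
    using less.prems(4) by (metis (full_types) leI not_le_imp_less)
  then show ?case
  proof cases
    case small
    then show ?thesis using cardU by (intro exI covers_but_small) auto
  next
    case balanced
    have "covers_but (tight_component (F i) eA \<union> tight_component (F (\<not> i)) eB) (A \<union> B) (9 * s)"
    proof (rule covers_balanced)
      fix x y z
      assume xyz: "triple x y z" "{x, y, z} \<subseteq> A \<union> B" "\<not> {x, y, z} \<subseteq> A" "\<not> {x, y, z} \<subseteq> B"
      then have "x \<in> A \<or> y \<in> A \<or> z \<in> A" "x \<in> B \<or> y \<in> B \<or> z \<in> B" "x \<in> U" "y \<in> U" "z \<in> U"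
        using less.prems(1,2) by auto
      then show "{x, y, z} \<in> tight_component (F i) eA \<union> tight_component (F (\<not> i)) eB"
        using compA[OF xyz(1)] compB[OF xyz(1)] by blast
    qed (use balanced less.prems in auto)
    then show ?thesis ..
  next
    case remove
    note ne = triple_distinct[OF remove(5)]
    have c3: "card (A - {x, y, z}) = card A - 3" "card A \<ge> 3"
      using remove ne fin card_mono[of A "{x, y, z}"] by (auto simp: card_Diff_subset)
    \<comment> \<open>The removal can violate the first alternative only if very few vertices
      remain; the second alternative is there to catch this.\<close>
    have "card B \<le> 2 * card (A - {x, y, z}) \<or> real (card (A - {x, y, z}) + card B) \<le> 9 * s"
    proof (cases "card B \<le> 2 * card (A - {x, y, z})")
      case False
      then have "card (A - {x, y, z}) + card B \<le> 9" using c3 remove(1) by linarith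
      then show ?thesis using s_ge_1 by linarith
    qed simp
    then have "\<exists>f. covers_but (tight_component (F i) eA \<union> tight_component (F (\<not> i)) f)
        ((A - {x, y, z}) \<union> B) (9 * s)"
      using c3 less.prems by (intro less.hyps) auto
    moreover have "(A - {x, y, z}) \<union> B = A \<union> B - {x, y, z}" using remove less.prems(3) by auto
    ultimately obtain f where cov: "covers_but (tight_component (F i) eA \<union> tight_component (F (\<not> i)) f)
        (A \<union> B - {x, y, z}) (9 * s)" by auto
    have "{x, y, z} \<in> tight_component (F i) eA"
      using remove less.prems(1) by (intro compA) auto
    then show ?thesis using remove by (intro exI[of _ f] covers_but_insert[OF cov]) auto
  next
    case final
    \<comment> \<open>The constant 9 comes from here: with \<open>card B\<close> below half of
      \<open>card A\<close>, a total above \<open>9 * s\<close> puts more than \<open>6 * s\<close>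
      vertices into \<open>A\<close>, as \<open>tight_triples\<close> requires.\<close>
    have big: "card A > 6 * s" using final(1,2) by linarith
    have inF: "{x, y, z} \<in> F (\<not> i)" if "x \<in> A" "y \<in> A" "z \<in> A" "triple x y z" for x y z
      using final(3)[OF that] that by (auto simp: triple_def colour_class_def)
    note con = tight_triples[OF less.prems(1) big final(3)]
    have "\<exists>f. \<forall>x\<in>A \<union> B. \<forall>y\<in>A. \<forall>z\<in>A. triple x y z \<longrightarrow>
        {x, y, z} \<in> tight_component (F i) eA \<union> tight_component (F (\<not> i)) f"
    proof (cases "\<exists>x\<in>B. \<exists>y\<in>A. \<exists>z\<in>A. triple x y z \<and> c {x, y, z} \<noteq> i")
      case True
      then obtain p q r where pqr: "p \<in> B" "q \<in> A" "r \<in> A" "triple p q r" "c {p, q, r} \<noteq> i" by blast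
      \<comment> \<open>The pair \<open>q\<close>, \<open>r\<close> of the mixed edge also lies in
        an edge \<open>{q, r, w}\<close> inside \<open>A\<close>. This places the edges inside
        \<open>A\<close> in the component of \<open>eB\<close>.\<close>
      have "nice q r" using pqr by (auto simp: triple_def)
      then obtain w where w: "w \<in> A" "triple q r w"
        using ex_triple[OF less.prems(1), of q r] pqr less.prems(1) big s_ge_1 by (auto simp: subset_iff)
      have t: "tight (F (\<not> i)) eB {p, q, r}" and m: "{p, q, r} \<in> F (\<not> i)"
        using compB[OF pqr(4)] pqr less.prems(1,2) by (auto simp: tight_component_def)
      have "tight (F (\<not> i)) {p, q, r} {q, r, w}"
        using m inF[OF pqr(2,3) w] card_edge nice_neq[OF \<open>nice q r\<close>]
        by (intro tight_share[of _ _ _ q r]) (auto simp: colour_class_def)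
      with t have "tight (F (\<not> i)) eB {q, r, w}" by (rule rtranclp_trans)
      then have "{x, y, z} \<in> tight_component (F (\<not> i)) eB"
        if "x \<in> A" "y \<in> A" "z \<in> A" "triple x y z" for x y z
        using con[OF _ _ _ _ pqr(2,3) w that] inF[OF that]
        by (auto simp: tight_component_def)
      moreover have "{x, y, z} \<in> tight_component (F i) eA \<union> tight_component (F (\<not> i)) eB"
        if "x \<in> B" "y \<in> A" "z \<in> A" "triple x y z" for x y z
        using compA[OF that(4)] compB[OF that(4)] that less.prems(1,2) by blast
      ultimately show ?thesis by (intro exI[of _ eB]) blast
    next
      case False
      obtain p where p: "p \<in> A" using big s_ge_1 by (cases "A = {}") auto
      obtain q r where qr: "q \<in> A" "r \<in> A" "triple p q r"
        using ex_triple2[OF less.prems(1), of p] p less.prems(1) big s_ge_1 by auto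
      have "{x, y, z} \<in> tight_component (F (\<not> i)) {p, q, r}"
        if "x \<in> A" "y \<in> A" "z \<in> A" "triple x y z" for x y z
        using con[OF _ _ _ _ p qr that] inF[OF that] by (auto simp: tight_component_def)
      moreover have "{x, y, z} \<in> tight_component (F i) eA"
        if "x \<in> B" "y \<in> A" "z \<in> A" "triple x y z" for x y z
        using compA[OF that(4)] that less.prems(1,2) False by blast
      ultimately show ?thesis by blast
    qed
    then obtain f where f: "\<And>x y z. \<lbrakk>x \<in> A \<union> B; y \<in> A; z \<in> A; triple x y z\<rbrakk> \<Longrightarrow>
        {x, y, z} \<in> tight_component (F i) eA \<union> tight_component (F (\<not> i)) f" by blast
    have "covers_but (tight_component (F i) eA \<union> tight_component (F (\<not> i)) f) (A \<union> B) (5 * s)"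
      using less.prems final(1) f by (intro covers_unbalanced) auto
    from covers_but_mono[OF this, of "9 * s"] s_ge_1 show ?thesis by auto
  qed
qed

end

text \<open>Splitting \<open>M\<close> by component gives the two matchings. Their edges differ in
  colour, hence are distinct members of \<open>M\<close>, hence are disjoint.\<close>

lemma covers_but_imp_matchings:
  fixes k :: real
  assumes "covers_but (tight_component (colour_class E c i) e \<union> tight_component (colour_class E c (\<not> i)) f) S k"
    and "finite S"
  obtains M1 M2 where "mono_connected_matching E c M1" "mono_connected_matching E c M2"
    "disjnt (covered M1) (covered M2)" "card (covered M1 \<union> covered M2) \<ge> card S - k"
proof -
  let ?C = "\<lambda>j. tight_component (colour_class E c j)"
  obtain M where M: "M \<subseteq> ?C i e \<union> ?C (\<not> i) f" "pairwise disjnt M" "\<Union>M \<subseteq> S" "real (card (S - \<Union>M)) \<le> k"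
    using assms by (auto simp: covers_but_def)
  have mono: "mono_connected_matching E c (M \<inter> ?C j g)" for j g
    unfolding mono_connected_matching_def connected_matching_def matching_def
  proof (rule exI[of _ j], intro conjI ballI)
    show "M \<inter> ?C j g \<subseteq> colour_class E c j" by (auto simp: tight_component_def)
    show "pairwise disjnt (M \<inter> ?C j g)" using M(2) by (auto simp: pairwise_def)
    show "\<exists>es. pseudo_path (colour_class E c j) p q es" if "p \<in> M \<inter> ?C j g" "q \<in> M \<inter> ?C j g" for p q
    proof (rule tight_imp_pseudo_path)
      show "p \<in> colour_class E c j" using that by (auto simp: tight_component_def)
      show "tight (colour_class E c j) p q"
        using that by (auto simp: tight_component_def intro: rtranclp_trans[OF tight_sym])
    qed
  qed
  have "?C i e \<inter> ?C (\<not> i) f = {}" by (auto simp: tight_component_def colour_class_def)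
  then have "disjnt p q" if "p \<in> M \<inter> ?C i e" "q \<in> M \<inter> ?C (\<not> i) f" for p q
    using that pairwiseD[OF M(2), of p q] by blast
  then have "disjnt (covered (M \<inter> ?C i e)) (covered (M \<inter> ?C (\<not> i) f))"
    by (simp add: covered_def)
  moreover have "covered (M \<inter> ?C i e) \<union> covered (M \<inter> ?C (\<not> i) f) = \<Union>M"
    using M(1) by (auto simp: covered_def)
  moreover have "card (S - \<Union>M) = card S - real (card (\<Union>M))"
    using M(3) assms(2) by (intro real_card_Diff)
  ultimately show thesis using M(4) mono by (intro that) auto
qed

lemma covers_but_superset:
  fixes k l :: real
  assumes "covers_but F S k" "S \<subseteq> T" "finite T" "card (T - S) \<le> l"
  shows "covers_but F T (k + l)"
proof -
  obtain M where M: "M \<subseteq> F" "pairwise disjnt M" "\<Union>M \<subseteq> S" "real (card (S - \<Union>M)) \<le> k"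
    using assms(1) by (auto simp: covers_but_def)
  have "card (T - \<Union>M) \<le> card ((S - \<Union>M) \<union> (T - S))"
    using assms(2,3) finite_subset[OF assms(2,3)] by (intro card_mono) auto
  also have "\<dots> \<le> card (S - \<Union>M) + card (T - S)" by (rule card_Un_le)
  finally have "real (card (T - \<Union>M)) \<le> k + l" using M(4) assms(4) by linarith
  then show ?thesis unfolding covers_but_def using M assms(2) by (intro exI[of _ M]) auto
qed

section \<open>One component for all vertices of the same colour\<close>

context nice_pairs
begin

text \<open>\<open>k x\<close> and \<open>e0 x\<close> stand for the colour and the anchor of the
  component found in the link of \<open>x\<close>. Any two vertices of a large colour class have a
  common nice partner in it, which makes their components equal.\<close>

lemma ex_covers_coloured:
  assumes tight: "\<And>x y e. \<lbrakk>x \<in> U; y \<in> U; nice x y; e \<in> F (k x); x \<in> e; y \<in> e\<rbrakk> \<Longrightarrow> tight (F (k x)) (e0 x) e"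
    and ex: "\<And>x y. \<lbrakk>x \<in> U; y \<in> U; nice x y\<rbrakk> \<Longrightarrow> \<exists>e\<in>F (k x). x \<in> e \<and> y \<in> e"
  shows "\<exists>i eA f. covers_but (tight_component (F i) eA \<union> tight_component (F (\<not> i)) f) U (13 * s)"
proof -
  \<comment> \<open>A class of at most \<open>2 * s\<close> vertices may lack common nice partners
    and is discarded. The two classes lose at most \<open>4 * s\<close> vertices this way, whence
    \<open>9 * s + 4 * s = 13 * s\<close>.\<close>
  define D where "D i = (if card {x\<in>U. k x = i} > 2 * s then {x\<in>U. k x = i} else {})" for i
  have D: "D i \<subseteq> U" "x \<in> D i \<Longrightarrow> k x = i" for i x by (auto simp: D_def split: if_splits)
  have "\<exists>eA. \<forall>x\<in>D i. \<forall>y\<in>U. \<forall>e\<in>F i. nice x y \<longrightarrow> x \<in> e \<longrightarrow> y \<in> e \<longrightarrow> tight (F i) eA e" for i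
  proof (cases "D i = {}")
    case False
    then obtain a where a: "a \<in> D i" by auto
    have "tight (F i) (e0 a) e" if x: "x \<in> D i" and e: "y \<in> U" "e \<in> F i" "nice x y" "x \<in> e" "y \<in> e" for x y e
    proof -
      have xU: "x \<in> U" "a \<in> U" using x a D(1) by auto
      have "card (D i) > 2 * s" using False by (auto simp: D_def split: if_splits)
      then have "\<exists>z\<in>D i. \<forall>P\<in>set [\<lambda>z. \<not> nice a z, \<lambda>z. \<not> nice x z]. \<not> P z"
        using xU card_not_nice by (intro ex_avoid_U D(1)) auto
      then obtain z where z: "z \<in> D i" "nice a z" "nice x z" by auto
      have zU: "z \<in> U" using z(1) D(1) by auto
      have ki: "k a = i" "k x = i" "k z = i" using D(2) a x z(1) by auto
      \<comment> \<open>\<open>g\<close> lies in the components of \<open>a\<close> and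
        \<open>z\<close>, and \<open>h\<close> in those of \<open>z\<close> and
        \<open>x\<close>.\<close>
      obtain g h where g: "g \<in> F i" "a \<in> g" "z \<in> g" and h: "h \<in> F i" "x \<in> h" "z \<in> h"
        using ex[OF xU(2) zU z(2)] ex[OF xU(1) zU z(3)] ki by auto
      have "tight (F i) (e0 a) g" using tight[OF xU(2) zU z(2)] g ki by simp
      moreover have "tight (F i) (e0 z) g"
        using tight[OF zU xU(2) nice_sym[OF z(2)]] g ki by simp
      moreover have "tight (F i) (e0 z) h"
        using tight[OF zU xU(1) nice_sym[OF z(3)]] h ki by simp
      moreover have "tight (F i) (e0 x) h" using tight[OF xU(1) zU z(3)] h ki by simp
      moreover have "tight (F i) (e0 x) e" using tight[OF xU(1) e(1,3)] e ki by simp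
      ultimately show ?thesis by (meson rtranclp_trans tight_sym)
    qed
    then show ?thesis by blast
  qed simp
  then obtain eA where eA: "\<And>i x y e. \<lbrakk>x \<in> D i; y \<in> U; e \<in> F i; nice x y; x \<in> e; y \<in> e\<rbrakk> \<Longrightarrow> tight (F i) (eA i) e"
    by metis
  obtain i where i: "card (D (\<not> i)) \<le> card (D i)" using that[of True] that[of False] by (cases "card (D False) \<le> card (D True)") auto
  have dis: "D i \<inter> D (\<not> i) = {}" using D(2)[of _ i] D(2)[of _ "\<not> i"] by blast
  have "\<exists>f. covers_but (tight_component (F i) (eA i) \<union> tight_component (F (\<not> i)) f) (D i \<union> D (\<not> i)) (9 * s)"
    using i by (intro ex_covers[where eB = "eA (\<not> i)"] D(1) dis) (auto intro: eA)
  then obtain f where f: "covers_but (tight_component (F i) (eA i) \<union> tight_component (F (\<not> i)) f) (D i \<union> D (\<not> i)) (9 * s)" ..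
  have small: "card ({x\<in>U. k x = j} - D j) \<le> 2 * s" for j
    using s_ge_1 by (auto simp: D_def)
  have "card (U - (D i \<union> D (\<not> i))) \<le> card (({x\<in>U. k x = i} - D i) \<union> ({x\<in>U. k x = (\<not> i)} - D (\<not> i)))"
    using finite_U by (intro card_mono) auto
  also have "\<dots> \<le> card ({x\<in>U. k x = i} - D i) + card ({x\<in>U. k x = (\<not> i)} - D (\<not> i))" by (rule card_Un_le)
  finally have "card (U - (D i \<union> D (\<not> i))) \<le> 4 * s" using small[of i] small[of "\<not> i"] by linarith
  from covers_but_superset[OF f _ finite_U this] D(1) show ?thesis by (auto simp: algebra_simps)
qed

end

section \<open>Links and counting\<close>

text \<open>Consecutive edges of a walk in the link of \<open>x\<close> share a vertex, so the
  corresponding hyperedges share this vertex and \<open>x\<close>.\<close>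

lemma tight_link:
  assumes "(\<lambda>u v. {x, u, v} \<in> H)\<^sup>*\<^sup>* y y'" "{x, y, z} \<in> H" "{x, y', z'} \<in> H"
    and three: "\<And>e. e \<in> H \<Longrightarrow> card e = 3"
  shows "tight H {x, y, z} {x, y', z'}"
  using assms(1,3)
proof (induction arbitrary: z' rule: rtranclp_induct)
  case base
  have "x \<noteq> y" using three[OF assms(2)] by (auto simp: card_insert_if split: if_splits)
  then show ?case using base assms(2) three by (intro tight_share[of _ _ _ x y]) auto
next
  case (step u v)
  have "x \<noteq> v" using three[OF step.prems] by (auto simp: card_insert_if split: if_splits)
  then have "tight H {x, u, v} {x, v, z'}"
    using step three by (intro tight_share[of _ _ _ x v]) auto
  with step.IH[OF step.hyps(2)] show ?case by (rule rtranclp_trans)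
qed

text \<open>The link of \<open>x\<close> inherits a 2-colouring, and a walk in one of its components
  lifts to a chain of hyperedges through \<open>x\<close>.\<close>

lemma link_component:
  fixes d :: real
  assumes three: "\<And>e. e \<in> E \<Longrightarrow> card e = 3" and fin: "finite N" and x: "x \<notin> N"
    and deg: "\<And>y. y \<in> N \<Longrightarrow> card {z\<in>N. {x, y, z} \<notin> E} \<le> d"
    and big: "card N > 6 * d" and d: "d \<ge> 1"
  obtains i C e0 where "C \<subseteq> N" "card C \<ge> card N - 4 * d"
    "\<And>y. y \<in> C \<Longrightarrow> \<exists>e\<in>colour_class E c i. x \<in> e \<and> y \<in> e"
    "\<And>y e. \<lbrakk>y \<in> C; e \<in> colour_class E c i; x \<in> e; y \<in> e\<rbrakk> \<Longrightarrow> tight (colour_class E c i) e0 e"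
proof -
  define P where "P i u v \<longleftrightarrow> {x, u, v} \<in> colour_class E c i" for i u v
  have sym: "P i v u" if "P i u v" for i u v using that by (simp add: P_def insert_commute)
  have deg': "card {z\<in>N. \<forall>i. \<not> P i y z} \<le> d" if "y \<in> N" for y
  proof -
    have "{z\<in>N. \<forall>i. \<not> P i y z} = {z\<in>N. {x, y, z} \<notin> E}" by (auto simp: P_def colour_class_def)
    then show ?thesis using deg[OF that] by simp
  qed
  obtain i C where C: "C \<subseteq> N" "card C \<ge> card N - 4 * d"
    and con: "\<And>y z. \<lbrakk>y \<in> C; z \<in> C\<rbrakk> \<Longrightarrow> (P i)\<^sup>*\<^sup>* y z"
    by (rule two_colour_component[OF fin sym deg' big]) (use d in auto)
  let ?H = "colour_class E c i"
  have cC: "card C > 1" using C(2) big d by linarith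
  have H3: "card e = 3" if "e \<in> ?H" for e using that three by (auto simp: colour_class_def)
  \<comment> \<open>The first step of a walk from \<open>y\<close> to another vertex of
    \<open>C\<close>; its end \<open>z\<close> may lie outside \<open>C\<close>.\<close>
  have nb: "\<exists>z. P i y z" if "y \<in> C" for y
  proof -
    have "\<not> C \<subseteq> {y}" using cC card_mono[of "{y}" C] by auto
    then obtain y' where "y' \<in> C" "y' \<noteq> y" by auto
    then show ?thesis using con[OF that, of y'] by (auto elim: converse_rtranclpE)
  qed
  obtain y0 where y0: "y0 \<in> C" using cC by (cases "C = {}") auto
  obtain z0 where z0: "P i y0 z0" using nb[OF y0] ..
  show thesis
  proof (rule that[of C i "{x, y0, z0}"])
    show "\<exists>e\<in>?H. x \<in> e \<and> y \<in> e" if "y \<in> C" for y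
      using nb[OF that] unfolding P_def by blast
    show "tight ?H {x, y0, z0} e" if "y \<in> C" "e \<in> ?H" "x \<in> e" "y \<in> e" for y e
    proof -
      have "x \<noteq> y" using x C(1) that(1) by auto
      have "card (e - {x, y}) = 1" using H3[OF that(2)] that(3,4) \<open>x \<noteq> y\<close> by (simp add: card_Diff_subset)
      then obtain z where "e - {x, y} = {z}" by (auto simp: card_1_singleton_iff)
      then have e: "e = {x, y, z}" using that(3,4) by auto
      show ?thesis unfolding e
        using tight_link[of x ?H y0 y z0 z] con[OF y0 that(1)] z0 that(2) H3 by (simp add: P_def[abs_def] e)
    qed
  qed (use C in auto)
qed

text \<open>Markov's inequality for the degrees in the relation \<open>R\<close>, in product
  form.\<close>

lemma heavy_count:
  fixes a :: real
  assumes "finite A" "finite B" "a \<ge> 0"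
  shows "a * card {x\<in>A. card {y\<in>B. R x y} > a} \<le> card (SIGMA x:A. {y\<in>B. R x y})"
proof -
  have "a * card {x\<in>A. card {y\<in>B. R x y} > a} = (\<Sum>x | x \<in> A \<and> card {y\<in>B. R x y} > a. a)" by simp
  also have "\<dots> \<le> (\<Sum>x | x \<in> A \<and> card {y\<in>B. R x y} > a. real (card {y\<in>B. R x y}))"
    by (intro sum_mono) auto
  also have "\<dots> \<le> (\<Sum>x\<in>A. real (card {y\<in>B. R x y}))"
    using assms by (intro sum_mono2) auto
  also have "\<dots> = card (SIGMA x:A. {y\<in>B. R x y})"
    using assms by (subst card_SigmaI) auto
  finally show ?thesis .
qed

text \<open>A missing 3-set \<open>e\<close> accounts only for triples in
  \<open>(e \<times> e) \<times> e\<close>, which has 27 elements.\<close>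

lemma card_non_edges:
  assumes "uniform_hypergraph 3 V E"
  shows "card (SIGMA p:V \<times> V. {z\<in>V. card {fst p, snd p, z} = 3 \<and> {fst p, snd p, z} \<notin> E})
      \<le> 27 * (real (card V choose 3) - real (card E))"
proof -
  let ?K = "{e. e \<subseteq> V \<and> card e = 3}"
  have fin: "finite V" and E: "E \<subseteq> ?K" using assms by (auto simp: uniform_hypergraph_def)
  have fK: "finite ?K" using fin by simp
  have "((x, y), z) \<in> (\<Union>e\<in>?K - E. (e \<times> e) \<times> e)"
    if "x \<in> V" "y \<in> V" "z \<in> V" "card {x, y, z} = 3" "{x, y, z} \<notin> E" for x y z
    using that by (intro UN_I[of "{x, y, z}"]) auto
  then have "(SIGMA p:V \<times> V. {z\<in>V. card {fst p, snd p, z} = 3 \<and> {fst p, snd p, z} \<notin> E})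
      \<subseteq> (\<Union>e\<in>?K - E. (e \<times> e) \<times> e)"
    by auto
  then have "card (SIGMA p:V \<times> V. {z\<in>V. card {fst p, snd p, z} = 3 \<and> {fst p, snd p, z} \<notin> E})
      \<le> card (\<Union>e\<in>?K - E. (e \<times> e) \<times> e)"
    using fin fK by (intro card_mono finite_UN_I finite_cartesian_product) (auto intro: finite_subset)
  also have "\<dots> \<le> (\<Sum>e\<in>?K - E. card ((e \<times> e) \<times> e))" using fK by (intro card_UN_le) auto
  also have "\<dots> = 27 * card (?K - E)" by (simp add: card_cartesian_product)
  finally have "real (card (SIGMA p:V \<times> V. {z\<in>V. card {fst p, snd p, z} = 3 \<and> {fst p, snd p, z} \<notin> E}))
      \<le> real (27 * card (?K - E))"
    by (rule of_nat_mono)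
  also have "\<dots> = 27 * (real (card V choose 3) - real (card E))"
    using real_card_Diff[OF fK E] n_subsets[OF fin, of 3] by simp
  finally show ?thesis .
qed

text \<open>In units of \<open>\<eta> * card V\<close>, the uncovered part is at most 1 for
  \<open>V - G\<close>, 6 for \<open>G - U\<close> and \<open>13 * 2\<close> for the covering of
  \<open>U\<close>: 33 in total.\<close>

lemma ex_mono_connected_matchings:
  fixes \<eta> :: real and V :: "'a set"
  assumes H: "uniform_hypergraph 3 V E" and \<eta>: "0 < \<eta>" "\<eta> < 1/290"
    and large: "\<eta>^2 * card V \<ge> 5"
    and dense: "real (card E) \<ge> (1 - \<eta>^6) * real (card V choose 3)"
  obtains M1 M2 where "mono_connected_matching E c M1" "mono_connected_matching E c M2"
    "disjnt (covered M1) (covered M2)" "card (covered M1 \<union> covered M2) \<ge> (1 - 33 * \<eta>) * card V"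
proof -
  define t where "t = real (card V)"
  \<comment> \<open>With this threshold there are at most \<open>27 * \<eta>^4 * t^2\<close> bad
    pairs, and at most \<open>27 * q\<close> vertices lie in more than \<open>q\<close> of
    them.\<close>
  define q where "q = \<eta>^2 * t"
  have fin: "finite V" and EV: "\<And>e. e \<in> E \<Longrightarrow> e \<subseteq> V" and three: "\<And>e. e \<in> E \<Longrightarrow> card e = 3"
    using H by (auto simp: uniform_hypergraph_def)
  have q5: "q \<ge> 5" using large by (simp add: q_def t_def)
  have t0: "t > 0" using q5 by (cases "t = 0") (auto simp: q_def t_def)
  \<comment> \<open>Since \<open>\<eta> < 1/290\<close>, the multiples of \<open>q\<close> that
    occur as errors are absorbed by \<open>\<eta> * t\<close>.\<close>
  have q_le: "290 * q \<le> \<eta> * t"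
    using mult_right_mono[of "290 * \<eta>" 1 "\<eta> * t"] \<eta> t0 by (simp add: q_def power2_eq_square)
  have "290 * (\<eta> * t) \<le> t" using mult_right_mono[of "290 * \<eta>" 1 t] \<eta> t0 by simp
  then have q_le_t: "290 * q \<le> t" using q_le q5 by simp
  define miss where "miss x y = {z\<in>V. card {x, y, z} = 3 \<and> {x, y, z} \<notin> E}" for x y
  define bad where "bad x y \<longleftrightarrow> card (miss x y) > q" for x y
  define G where "G = {x\<in>V. \<not> card {y\<in>V. bad x y} > q}"
  have GV: "G \<subseteq> V" and finG: "finite G" using fin by (auto simp: G_def)
  \<comment> \<open>Markov's inequality, for pairs in few edges, then for vertices in many such pairs, and
    below for vertices outside the components of many others, leaves out few vertices.\<close>
  have bad_pairs: "card {p\<in>V \<times> V. bad (fst p) (snd p)} \<le> 27 * \<eta>^4 * t^2"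
  proof -
    have "q * card {p\<in>V \<times> V. bad (fst p) (snd p)} \<le> card (SIGMA p:V \<times> V. miss (fst p) (snd p))"
      unfolding bad_def miss_def using fin q5 by (intro heavy_count) auto
    also have "\<dots> \<le> 27 * (real (card V choose 3) - real (card E))"
      unfolding miss_def by (rule card_non_edges[OF H])
    also have "\<dots> \<le> 27 * (\<eta>^6 * real (card V choose 3))" using dense by (simp add: algebra_simps)
    also have "real (card V choose 3) \<le> t^3"
    proof (cases "3 \<le> card V")
      case True
      then show ?thesis unfolding t_def using binomial_le_pow[OF True] by (simp flip: of_nat_power)
    qed (use t0 in \<open>simp add: binomial_eq_0\<close>)
    finally have "q * card {p\<in>V \<times> V. bad (fst p) (snd p)} \<le> q * (27 * \<eta>^4 * t^2)"
      using \<eta> by (simp add: q_def mult_ac power_numeral_reduce)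
    then show ?thesis using q5 by simp
  qed
  have card_VG: "card (V - G) \<le> \<eta> * t"
  proof -
    have "q * card (V - G) = q * card {x\<in>V. card {y\<in>V. bad x y} > q}"
      by (intro arg_cong2[where f = "(*)"] arg_cong[where f = "\<lambda>A. real (card A)"]) (auto simp: G_def)
    also have "\<dots> \<le> card (SIGMA x:V. {y\<in>V. bad x y})" using fin q5 by (intro heavy_count) auto
    also have "(SIGMA x:V. {y\<in>V. bad x y}) = {p\<in>V \<times> V. bad (fst p) (snd p)}" by auto
    also have "card \<dots> \<le> 27 * \<eta>^4 * t^2" by (rule bad_pairs)
    also have "\<dots> = q * (27 * q)" by (simp add: q_def power2_eq_square power_numeral_reduce)
    finally have "card (V - G) \<le> 27 * q" using q5 by simp
    then show ?thesis using q_le q5 by linarith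
  qed
  define link where "link x i C e0 \<longleftrightarrow> C \<subseteq> V - {x} \<and> (\<forall>y\<in>C. \<not> bad x y) \<and> card (V - C) \<le> 6 * q \<and>
      (\<forall>y\<in>C. \<exists>e\<in>colour_class E c i. x \<in> e \<and> y \<in> e) \<and>
      (\<forall>y\<in>C. \<forall>e\<in>colour_class E c i. x \<in> e \<longrightarrow> y \<in> e \<longrightarrow> tight (colour_class E c i) e0 e)" for x i C e0
  have "\<exists>i C e0. link x i C e0"
    if x: "x \<in> G" for x
  proof -
    define N where "N = {y\<in>V - {x}. \<not> bad x y}"
    have finN: "finite N" and NV: "N \<subseteq> V" using fin by (auto simp: N_def)
    have "card (V - N) \<le> card ({x} \<union> {y\<in>V. bad x y})" using fin by (intro card_mono) (auto simp: N_def)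
    also have "\<dots> \<le> 1 + card {y\<in>V. bad x y}" using card_Un_le[of "{x}"] by simp
    finally have "card (V - N) \<le> 1 + q" using x by (simp add: G_def)
    then have cN: "card N \<ge> t - 1 - q" using real_card_Diff[OF fin NV] by (simp add: t_def)
    have deg: "card {z\<in>N. {x, y, z} \<notin> E} \<le> q + 1" if y: "y \<in> N" for y
    proof -
      \<comment> \<open>The choice \<open>z = y\<close> yields a 2-set, which is no edge; it
        contributes the \<open>+ 1\<close>.\<close>
      have "{z\<in>N. {x, y, z} \<notin> E} \<subseteq> {y} \<union> miss x y"
        using y by (auto simp: N_def miss_def card_insert_if)
      then have "card {z\<in>N. {x, y, z} \<notin> E} \<le> card ({y} \<union> miss x y)"
        using fin by (intro card_mono) (auto simp: miss_def)
      also have "\<dots> \<le> 1 + card (miss x y)" using card_Un_le[of "{y}"] by simp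
      finally show ?thesis using y by (simp add: N_def bad_def)
    qed
    have big: "card N > 6 * (q + 1)" using cN q_le_t q5 by simp
    have xN: "x \<notin> N" by (simp add: N_def)
    obtain i C e0 where C: "C \<subseteq> N" "card C \<ge> card N - 4 * (q + 1)"
      "\<And>y. y \<in> C \<Longrightarrow> \<exists>e\<in>colour_class E c i. x \<in> e \<and> y \<in> e"
      "\<And>y e. \<lbrakk>y \<in> C; e \<in> colour_class E c i; x \<in> e; y \<in> e\<rbrakk> \<Longrightarrow> tight (colour_class E c i) e0 e"
      by (rule link_component[OF three finN xN deg big, where c = c]) (use q5 in auto)
    \<comment> \<open>The loss is \<open>(q + 1) + 4 * (q + 1)\<close>, and \<open>q \<ge> 5\<close>
      bounds this by \<open>6 * q\<close>.\<close>
    have "card (V - C) \<le> 6 * q"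
      using real_card_Diff[OF fin, of C] C(1,2) NV cN q5 by (simp add: t_def)
    then show ?thesis using C by (intro exI[of _ i] exI[of _ C] exI[of _ e0]) (auto simp: N_def link_def)
  qed
  then obtain k C e0 where link: "\<And>x. x \<in> G \<Longrightarrow> link x (k x) (C x) (e0 x)" by metis
  then have CV: "\<And>x. x \<in> G \<Longrightarrow> C x \<subseteq> V - {x}"
    and not_bad: "\<And>x y. \<lbrakk>x \<in> G; y \<in> C x\<rbrakk> \<Longrightarrow> \<not> bad x y"
    and card_C: "\<And>x. x \<in> G \<Longrightarrow> card (V - C x) \<le> 6 * q"
    and ex_edge: "\<And>x y. \<lbrakk>x \<in> G; y \<in> C x\<rbrakk> \<Longrightarrow> \<exists>e\<in>colour_class E c (k x). x \<in> e \<and> y \<in> e"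
    and tight: "\<And>x y e. \<lbrakk>x \<in> G; y \<in> C x; e \<in> colour_class E c (k x); x \<in> e; y \<in> e\<rbrakk>
      \<Longrightarrow> tight (colour_class E c (k x)) (e0 x) e"
    by (simp_all add: link_def)
  \<comment> \<open>The relation \<open>y \<in> C x\<close> need not be symmetric. Vertices that lie
    in almost all sets \<open>C x\<close> are kept, so that demanding both directions in
    \<open>nice\<close> excludes few pairs.\<close>
  define U where "U = {y\<in>G. \<not> card {x\<in>G. y \<notin> C x} > \<eta> * t}"
  have UG: "U \<subseteq> G" by (auto simp: U_def)
  have card_GU: "card (G - U) \<le> 6 * (\<eta> * t)"
  proof -
    have "\<eta> * t * card (G - U) = \<eta> * t * card {y\<in>G. card {x\<in>G. y \<notin> C x} > \<eta> * t}"
      by (intro arg_cong2[where f = "(*)"] arg_cong[where f = "\<lambda>A. real (card A)"]) (auto simp: U_def)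
    also have "\<dots> \<le> card (SIGMA y:G. {x\<in>G. y \<notin> C x})" using finG \<eta> t0 by (intro heavy_count) auto
    \<comment> \<open>The same pairs are now counted by \<open>x\<close>, where each set
      \<open>C x\<close> misses at most \<open>6 * q\<close> vertices.\<close>
    also have "(SIGMA y:G. {x\<in>G. y \<notin> C x}) = (SIGMA x:G. G - C x)\<inverse>" by auto
    also have "real (card \<dots>) = (\<Sum>x\<in>G. real (card (G - C x)))" using finG by simp
    also have "\<dots> \<le> (\<Sum>x\<in>G. 6 * q)"
    proof (rule sum_mono)
      fix x assume x: "x \<in> G"
      have "card (G - C x) \<le> card (V - C x)" using GV fin by (intro card_mono) auto
      then show "card (G - C x) \<le> 6 * q" using card_C[OF x] by linarith
    qed
    also have "\<dots> = 6 * q * card G" by simp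
    also have "\<dots> \<le> 6 * q * t" using card_mono[OF fin GV] q5 by (intro mult_left_mono) (auto simp: t_def)
    also have "\<dots> = \<eta> * t * (6 * (\<eta> * t))" by (simp add: q_def power2_eq_square)
    finally show ?thesis using \<eta> t0 by simp
  qed
  define nice where "nice x y \<longleftrightarrow> x \<in> U \<and> y \<in> U \<and> x \<in> C y \<and> y \<in> C x" for x y
  \<comment> \<open>A vertex \<open>x\<close> of \<open>U\<close> is outside \<open>C y\<close> for
    at most \<open>\<eta> * t\<close> vertices \<open>y\<close> of \<open>G\<close>, and
    \<open>C x\<close> misses at most \<open>6 * q \<le> \<eta> * t\<close> vertices; together
    \<open>2 * (\<eta> * t)\<close>.\<close>
  interpret nice_pairs E c U nice "2 * (\<eta> * t)"
  proof
    show "finite U" using UG finG finite_subset by blast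
    show "nice y x" if "nice x y" for x y using that by (simp add: nice_def)
    show "x \<noteq> y" if "nice x y" for x y using that CV UG by (fastforce simp: nice_def)
    show "2 * (\<eta> * t) \<ge> 1" using q_le q5 by linarith
    show "card {y\<in>U. \<not> nice x y} \<le> 2 * (\<eta> * t)" if x: "x \<in> U" for x
    proof -
      have "card {y\<in>U. \<not> nice x y} \<le> card ({y\<in>G. x \<notin> C y} \<union> (V - C x))"
        using fin finG x UG GV by (intro card_mono) (auto simp: nice_def)
      also have "\<dots> \<le> card {y\<in>G. x \<notin> C y} + card (V - C x)" by (rule card_Un_le)
      finally show ?thesis using x UG card_C[of x] q_le q5 by (auto simp: U_def)
    qed
    show "card {z\<in>U. {x, y, z} \<notin> E} \<le> 2 * (\<eta> * t)" if x: "x \<in> U" "y \<in> U" "nice x y" for x y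
    proof -
      have "x \<noteq> y" "\<not> bad x y" using x CV not_bad UG by (fastforce simp: nice_def)+
      have "card {z\<in>U. {x, y, z} \<notin> E} \<le> card ({x, y} \<union> miss x y)"
        using fin UG GV \<open>x \<noteq> y\<close> by (intro card_mono) (auto simp: miss_def card_insert_if)
      also have "\<dots> \<le> card {x, y} + card (miss x y)" by (rule card_Un_le)
      also have "\<dots> = 2 + card (miss x y)" using \<open>x \<noteq> y\<close> by simp
      finally show ?thesis using \<open>\<not> bad x y\<close> q_le q5 by (simp add: bad_def)
    qed
  qed (rule three)
  have "\<exists>i eA f. covers_but (tight_component (F i) eA \<union> tight_component (F (\<not> i)) f) U (13 * (2 * (\<eta> * t)))"
    using tight ex_edge UG by (intro ex_covers_coloured[of k e0]) (auto simp: nice_def)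
  then obtain i eA f where
    cov: "covers_but (tight_component (F i) eA \<union> tight_component (F (\<not> i)) f) U (13 * (2 * (\<eta> * t)))"
    by blast
  have UV: "U \<subseteq> V" using UG GV by simp
  have "card (V - U) = card (V - G) + card (G - U)"
    using fin finG UG GV by (subst card_Un_disjoint[symmetric]) (auto intro: arg_cong[where f = card])
  then have "card (V - U) \<le> 7 * (\<eta> * t)" using card_VG card_GU by simp
  from covers_but_imp_matchings[OF covers_but_superset[OF cov UV fin this] fin]
  obtain M1 M2 where "mono_connected_matching E c M1" "mono_connected_matching E c M2"
    "disjnt (covered M1) (covered M2)"
    "card (covered M1 \<union> covered M2) \<ge> card V - (13 * (2 * (\<eta> * t)) + 7 * (\<eta> * t))" .
  then show thesis by (intro that[of M1 M2]) (auto simp: t_def algebra_simps)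
qed

theorem theorem1p3:
  fixes \<gamma> :: real
  assumes "\<gamma> > 0"
  shows "\<exists>t0 :: nat. \<forall>(t :: nat) (V :: 'a set) (E :: 'a set set).
           t > t0 \<longrightarrow> uniform_hypergraph 3 V E \<longrightarrow> card V = t \<longrightarrow>
           real (card E) \<ge> (1 - \<gamma>) * real (t choose 3) \<longrightarrow>
           (\<forall>c :: 'a set \<Rightarrow> bool. \<exists>M1 M2.
              mono_connected_matching E c M1 \<and> mono_connected_matching E c M2 \<and>
              disjnt (covered M1) (covered M2) \<and>
              real (card (covered M1 \<union> covered M2)) \<ge> (1 - 290 * \<gamma> powr (1/6)) * real t)"
proof -
  define \<eta> where "\<eta> = \<gamma> powr (1/6)"
  have \<eta>: "\<eta> > 0" "\<eta>^6 = \<gamma>"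
    using assms by (simp_all add: \<eta>_def powr_powr flip: powr_realpow)
  \<comment> \<open>Every \<open>t > t0\<close> then satisfies
    \<open>\<eta>^2 * t \<ge> 5\<close>.\<close>
  obtain t0 :: nat where t0: "5 / \<eta>^2 < t0" using reals_Archimedean2 by blast
  show ?thesis unfolding \<eta>_def[symmetric]
  proof (intro exI[of _ t0] allI impI)
    fix t and V :: "'a set" and E and c :: "'a set \<Rightarrow> bool"
    assume t: "t > t0" and H: "uniform_hypergraph 3 V E" "card V = t"
      and dense: "real (card E) \<ge> (1 - \<gamma>) * real (t choose 3)"
    show "\<exists>M1 M2. mono_connected_matching E c M1 \<and> mono_connected_matching E c M2 \<and>
        disjnt (covered M1) (covered M2) \<and>
        real (card (covered M1 \<union> covered M2)) \<ge> (1 - 290 * \<eta>) * real t"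
    proof (cases "\<eta> < 1/290")
      case True
      have "5 / \<eta>^2 \<le> t" using t0 t by linarith
      then have "\<eta>^2 * card V \<ge> 5" using \<eta>(1) H(2) by (simp add: field_simps)
      then obtain M1 M2 where M: "mono_connected_matching E c M1" "mono_connected_matching E c M2"
        "disjnt (covered M1) (covered M2)" "card (covered M1 \<union> covered M2) \<ge> (1 - 33 * \<eta>) * card V"
        using ex_mono_connected_matchings[OF H(1) \<eta>(1) True] dense \<eta>(2) H(2) by metis
      have "(1 - 290 * \<eta>) * t \<le> (1 - 33 * \<eta>) * t" using \<eta>(1) by (intro mult_right_mono) auto
      then show ?thesis using M H(2) by (intro exI[of _ M1] exI[of _ M2]) auto
    next
      \<comment> \<open>The required number of covered vertices is at most 0, so two empty matchings
        suffice.\<close>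
      case False
      have "mono_connected_matching E c {}"
        by (auto simp: mono_connected_matching_def connected_matching_def matching_def)
      moreover have "(1 - 290 * \<eta>) * t \<le> 0" using False by (intro mult_nonpos_nonneg) auto
      ultimately show ?thesis by (intro exI[of _ "{}"]) (auto simp: covered_def disjnt_def)
    qed
  qed
qed

end
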